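(* Fix $\lambda\ge0$ and run the primal-dual algorithm described in the context with parameter $\bar B$. Let $T$ be the returned set of centers, $i(j)$ the point of $T$ nearest to $j$, and $S=\{j\in\mathcal D:\exists i\in T \text{ with } \beta_{ij}>0\}$. Then $$3\lambda|T|+\sum_{j\in S}f_{\bar B}(c_{i(j)j})+\sum_{j\notin S}f_{3\bar B}(c_{i(j)j})\le 3\sum_j\alpha_j.$$
   Context: Setting: $\ell$-centrum problem on a finite metric space $(\mathcal D,\{c_{ij}\})$ with $n=|\mathcal D|>k$, integers $k\ge0$, $\ell\in\{1,\dots,n\}$ (choose $k$ centers, minimize the sum of the $\ell$ largest assignment costs, optimum $\mathrm{opt}$). For $B\ge0$, $f_B(d)=d$ if $d>B/\ell$ and $0$ otherwise. $\mathrm{OPT}_B$ is the optimal value of LP (P$_B$): min $\sum_{i,j}f_B(c_{ij})x_{ij}$ s.t. $\sum_i x_{ij}\ge1$, $0\le x_{ij}\le y_i$, $\sum_iy_i\le k$. $\bar B$ is a number with $\mathrm{OPT}_{\bar B}\le\bar B\le(1+\epsilon)\mathrm{opt}$. Dual variables: $\alpha_j$ ($j\in\mathcal D$), $\beta_{ij}$ ($i,j\in\mathcal D$), with dual constraints $\alpha_j\le f_{\bar B}(c_{ij})+\beta_{ij}$, $\sum_j\beta_{ij}\le\lambda$, $\alpha,\lambda\ge0$. Algorithm for fixed $\lambda$: (1) Dual ascent: start with all clients active, $\alpha=\beta=0$, $F=\emptyset$; say $j$ reaches $i$ if $\alpha_j\ge f_{\bar B}(c_{ij})$. Until no client is active,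 raise uniformly the $\alpha_j$ of all active clients and the $\beta_{ij}$ of all pairs with $i\notin F$, $j$ active and $j$ reaching $i$, until one of these events: (a) some client $j$ newly reaches some $i\in F$: then $j$ is frozen (made inactive); (b) $\sum_j\beta_{ij}=\lambda$ for some $i\notin F$: then $i$ is added to $F$ and every active client that reaches $i$ is frozen. (2) Pruning: pick a maximal subset $T\subseteq F$ such that for every $j\in\mathcal D$ there is at most one $i\in T$ with $\beta_{ij}>0$. (3) Return $T$ as centers, assigning each client to its nearest point of $T$. *)

theory Defs
  imports "HOL-Analysis.Analysis" "HOL-Library.Multiset"
begin

section \<open>The l-centrum problem\<close>

text \<open>Without centers the assignment cost is the infimum of the empty set, that is, infinity.\<close>

definition assign_cost :: "('a \<Rightarrow> 'a \<Rightarrow> real) \<Rightarrow> 'a set \<Rightarrow> 'a \<Rightarrow> ereal" where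
  "assign_cost c C j = (INF i\<in>C. ereal (c i j))"

definition sum_largest :: "nat \<Rightarrow> 'b::{linorder,comm_monoid_add} multiset \<Rightarrow> 'b" where
  "sum_largest l M = sum_list (take l (rev (sorted_list_of_multiset M)))"

definition centrum_opt :: "'a set \<Rightarrow> ('a \<Rightarrow> 'a \<Rightarrow> real) \<Rightarrow> nat \<Rightarrow> nat \<Rightarrow> ereal" where
  "centrum_opt D c k l =
     (INF C\<in>{C. C \<subseteq> D \<and> card C = k}. sum_largest l (image_mset (assign_cost c C) (mset_set D)))"


section \<open>Truncated costs and the linear program\<close>

definition trunc_cost :: "nat \<Rightarrow> real \<Rightarrow> real \<Rightarrow> real" where
  "trunc_cost l B d = (if d > B / real l then d else 0)"

definition lp_feasible :: "'a set \<Rightarrow> nat \<Rightarrow> ('a \<Rightarrow> 'a \<Rightarrow> real) \<Rightarrow> ('a \<Rightarrow> real) \<Rightarrow> bool" where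
  "lp_feasible D k x y \<longleftrightarrow>
     (\<forall>j\<in>D. (\<Sum>i\<in>D. x i j) \<ge> 1) \<and>
     (\<forall>i\<in>D. \<forall>j\<in>D. 0 \<le> x i j \<and> x i j \<le> y i) \<and>
     (\<Sum>i\<in>D. y i) \<le> real k"

text \<open>The value is infinity if the linear program is infeasible (which happens only for \<open>k = 0\<close>).\<close>

definition lp_opt :: "'a set \<Rightarrow> ('a \<Rightarrow> 'a \<Rightarrow> real) \<Rightarrow> nat \<Rightarrow> nat \<Rightarrow> real \<Rightarrow> ereal" where
  "lp_opt D c k l B =
     (INF (x, y)\<in>{(x, y). lp_feasible D k x y}.
        ereal (\<Sum>i\<in>D. \<Sum>j\<in>D. trunc_cost l B (c i j) * x i j))"


section \<open>The primal-dual algorithm\<close>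

text \<open>In this section \<open>w i j\<close> is the truncated cost between center \<open>i\<close> and client \<open>j\<close>;
  \<open>opened\<close> is the set \<open>F\<close> of the algorithm.\<close>

record 'a ascent_state =
  active :: "'a set"
  alpha :: "'a \<Rightarrow> real"
  beta :: "'a \<Rightarrow> 'a \<Rightarrow> real"
  opened :: "'a set"

definition initial_state :: "'a set \<Rightarrow> 'a ascent_state" where
  "initial_state D = \<lparr>active = D, alpha = (\<lambda>_. 0), beta = (\<lambda>_ _. 0), opened = {}\<rparr>"

definition reaches :: "('a \<Rightarrow> 'a \<Rightarrow> real) \<Rightarrow> 'a ascent_state \<Rightarrow> 'a \<Rightarrow> 'a \<Rightarrow> bool" where
  "reaches w s j i \<longleftrightarrow> alpha s j \<ge> w i j"

text \<open>The state after raising the duals at unit rate for a time \<open>d\<close> during which neither the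
  active clients nor the opened centers change.  While \<open>alpha j\<close> moves from \<open>a\<close> to \<open>a + d\<close>, the
  variable \<open>beta i j\<close> is raised only on the part of that interval where the moving value is at
  least \<open>w i j\<close>, whose length is \<open>max 0 (min d (a + d - w i j))\<close>.\<close>

definition raise_duals ::
  "'a set \<Rightarrow> ('a \<Rightarrow> 'a \<Rightarrow> real) \<Rightarrow> real \<Rightarrow> 'a ascent_state \<Rightarrow> 'a ascent_state" where
  "raise_duals D w d s = s\<lparr>
     alpha := (\<lambda>j. if j \<in> active s then alpha s j + d else alpha s j),
     beta := (\<lambda>i j. if i \<in> D - opened s \<and> j \<in> active s
                    then beta s i j + max 0 (min d (alpha s j + d - w i j))
                    else beta s i j)\<rparr>"

text \<open>Opening a center freezes all active clients that reach it, so an active client that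
  reaches an opened center has always newly reached it.\<close>

definition freeze_event :: "('a \<Rightarrow> 'a \<Rightarrow> real) \<Rightarrow> 'a ascent_state \<Rightarrow> 'a \<Rightarrow> bool" where
  "freeze_event w s j \<longleftrightarrow> j \<in> active s \<and> (\<exists>i\<in>opened s. reaches w s j i)"

definition open_event :: "'a set \<Rightarrow> real \<Rightarrow> 'a ascent_state \<Rightarrow> 'a \<Rightarrow> bool" where
  "open_event D lam s i \<longleftrightarrow> i \<in> D - opened s \<and> (\<Sum>j\<in>D. beta s i j) = lam"

definition event_occurs ::
  "'a set \<Rightarrow> ('a \<Rightarrow> 'a \<Rightarrow> real) \<Rightarrow> real \<Rightarrow> 'a ascent_state \<Rightarrow> bool" where
  "event_occurs D w lam s \<longleftrightarrow> (\<exists>j. freeze_event w s j) \<or> (\<exists>i. open_event D lam s i)"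

text \<open>Duals are raised exactly up to the next event.  Simultaneous events are processed one
  after the other, in any order.  The \<open>open\<close> rule does not require an active client: centers that
  are tight when the last client is frozen may or may not be opened.\<close>

inductive ascent_step ::
  "'a set \<Rightarrow> ('a \<Rightarrow> 'a \<Rightarrow> real) \<Rightarrow> real \<Rightarrow> 'a ascent_state \<Rightarrow> 'a ascent_state \<Rightarrow> bool"
  for D w lam where
  raise: "\<lbrakk>active s \<noteq> {}; 0 < d;
           \<And>d'. \<lbrakk>0 \<le> d'; d' < d\<rbrakk> \<Longrightarrow> \<not> event_occurs D w lam (raise_duals D w d' s);
           event_occurs D w lam (raise_duals D w d s)\<rbrakk>
          \<Longrightarrow> ascent_step D w lam s (raise_duals D w d s)"
| freeze: "freeze_event w s j
          \<Longrightarrow> ascent_step D w lam s (s\<lparr>active := active s - {j}\<rparr>)"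
| "open": "open_event D lam s i
          \<Longrightarrow> ascent_step D w lam s
                (s\<lparr>opened := insert i (opened s),
                   active := active s - {j. reaches w s j i}\<rparr>)"

definition ascent_result ::
  "'a set \<Rightarrow> ('a \<Rightarrow> 'a \<Rightarrow> real) \<Rightarrow> real \<Rightarrow> 'a ascent_state \<Rightarrow> bool" where
  "ascent_result D w lam s \<longleftrightarrow>
     (ascent_step D w lam)\<^sup>*\<^sup>* (initial_state D) s \<and> active s = {}"

definition no_conflict :: "'a set \<Rightarrow> 'a ascent_state \<Rightarrow> 'a set \<Rightarrow> bool" where
  "no_conflict D s T \<longleftrightarrow> (\<forall>j\<in>D. \<exists>\<^sub>\<le>\<^sub>1 i. i \<in> T \<and> beta s i j > 0)"

definition pruning_result :: "'a set \<Rightarrow> 'a ascent_state \<Rightarrow> 'a set \<Rightarrow> bool" where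
  "pruning_result D s T \<longleftrightarrow>
     T \<subseteq> opened s \<and> no_conflict D s T \<and>
     (\<forall>T'. T \<subseteq> T' \<and> T' \<subseteq> opened s \<and> no_conflict D s T' \<longrightarrow> T' = T)"

end

theory Submission
  imports Defs
begin

text \<open>The ascent keeps \<open>beta i j = max 0 (alpha j - w i j)\<close> and fills every opened center to exactly
  \<open>lam\<close>, so clients contributing to a center of \<open>T\<close> pay three times for it and still cover their own
  connection cost.  A client \<open>j\<close> outside \<open>S\<close> was frozen by an opened center \<open>i\<close>, at a time
  \<open>alpha j\<close> that no contributor to \<open>i\<close> outlived.  If \<open>i\<close> was pruned, some \<open>j'\<close> contributes
  both to \<open>i\<close> and to some \<open>i' \<in> T\<close>, and the path from \<open>j\<close> to \<open>i'\<close> through \<open>i\<close> and \<open>j'\<close> has three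
  edges, each of truncated cost at most \<open>alpha j\<close>.  If the distance from \<open>j\<close> to \<open>i'\<close> exceeds
  \<open>3 * B / l\<close>, then the longest edge exceeds \<open>B / l\<close>, so it is not truncated.\<close>

lemma trunc_cost_nonneg:
  assumes "0 \<le> B"
  shows "0 \<le> trunc_cost l B d"
proof -
  have "0 \<le> B / real l"
    using assms by simp
  then show ?thesis
    unfolding trunc_cost_def by simp
qed

lemma trunc_cost_mono: "0 \<le> B \<Longrightarrow> x \<le> y \<Longrightarrow> trunc_cost l B x \<le> trunc_cost l B y"
  using trunc_cost_nonneg[of B l y] by (auto simp: trunc_cost_def)

lemma trunc_cost_le_triple:
  assumes "0 \<le> B" and "d \<le> x + y + z"
    and "trunc_cost l B x \<le> a" "trunc_cost l B y \<le> a" "trunc_cost l B z \<le> a"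
  shows "trunc_cost l (3 * B) d \<le> 3 * a"
proof (cases "d > 3 * B / real l")
  case True
  define m where "m = max x (max y z)"
  have "d \<le> 3 * m"
    using assms(2) by (auto simp: m_def)
  with True have "m > B / real l"
    by simp
  moreover have "trunc_cost l B m \<le> a"
    using assms(3-5) by (auto simp: m_def max_def)
  ultimately have "m \<le> a"
    by (simp add: trunc_cost_def)
  with \<open>d \<le> 3 * m\<close> True show ?thesis
    by (simp add: trunc_cost_def)
next
  case False
  then show ?thesis
    \<comment> \<open>The left side is 0, and \<open>a\<close> is nonnegative because it bounds a
      truncated cost.\<close>
    using trunc_cost_nonneg[OF assms(1), of l x] assms(3) by (simp add: trunc_cost_def)
qed

text \<open>All active clients share the same \<open>alpha\<close>, namely the elapsed time; this is the fifth
  conjunct.  In the last one, \<open>i\<close> is the center that froze \<open>j\<close>.\<close>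

definition ascent_invariant ::
  "'a set \<Rightarrow> ('a \<Rightarrow> 'a \<Rightarrow> real) \<Rightarrow> real \<Rightarrow> 'a ascent_state \<Rightarrow> bool" where
  "ascent_invariant D w lam s \<longleftrightarrow>
     active s \<subseteq> D \<and> opened s \<subseteq> D \<and>
     (\<forall>i\<in>D. \<forall>j\<in>D. beta s i j = max 0 (alpha s j - w i j)) \<and>
     (\<forall>i\<in>opened s. (\<Sum>j\<in>D. beta s i j) = lam) \<and>
     (\<forall>j\<in>active s. \<forall>j'\<in>D. alpha s j' \<le> alpha s j) \<and>
     (\<forall>j\<in>D - active s. \<exists>i\<in>opened s. w i j \<le> alpha s j \<and>
        (\<forall>j'\<in>D. beta s i j' > 0 \<longrightarrow> alpha s j' \<le> alpha s j))"

lemma ascent_invariant_initial: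
  assumes "\<And>i j. 0 \<le> w i j"
  shows "ascent_invariant D w lam (initial_state D)"
  using assms by (auto simp: ascent_invariant_def initial_state_def)

text \<open>The reached opened center serves as witness for \<open>j\<close>: an active client has
  the largest \<open>alpha\<close> of all, so no contributor to that center exceeds it.\<close>

lemma ascent_invariant_freeze:
  assumes "ascent_invariant D w lam s" "freeze_event w s j"
  shows "ascent_invariant D w lam (s\<lparr>active := active s - {j}\<rparr>)"
  using assms unfolding ascent_invariant_def freeze_event_def reaches_def by auto

lemma ascent_invariant_open:
  assumes "ascent_invariant D w lam s" "open_event D lam s i"
  shows "ascent_invariant D w lam
           (s\<lparr>opened := insert i (opened s), active := active s - {j. reaches w s j i}\<rparr>)"
  using assms unfolding ascent_invariant_def open_event_def reaches_def by auto

text \<open>Reaching an opened center before time \<open>d\<close> would already be an event;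
  reaching it exactly at \<open>d\<close> is allowed.\<close>

lemma alpha_le_opened_cost:
  assumes "0 < d"
    and no_event: "\<And>d'. \<lbrakk>0 \<le> d'; d' < d\<rbrakk> \<Longrightarrow> \<not> event_occurs D w lam (raise_duals D w d' s)"
    and "j \<in> active s" "i \<in> opened s"
  shows "alpha s j + d \<le> w i j"
proof (rule ccontr)
  assume *: "\<not> alpha s j + d \<le> w i j"
  \<comment> \<open>The moment at which \<open>j\<close> meets the cost of \<open>i\<close>; the
    \<open>max\<close> covers a client that reaches \<open>i\<close> from the start.\<close>
  define d' where "d' = max 0 (w i j - alpha s j)"
  have "0 \<le> d'" "d' < d"
    using * \<open>0 < d\<close> by (auto simp: d'_def)
  then have "\<not> event_occurs D w lam (raise_duals D w d' s)"
    by (rule no_event)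
  moreover have "freeze_event w (raise_duals D w d' s) j"
    using assms(3,4)
    by (auto simp: freeze_event_def raise_duals_def reaches_def d'_def intro!: bexI[of _ i])
  ultimately show False
    by (auto simp: event_occurs_def)
qed

lemma ascent_invariant_raise:
  assumes inv: "ascent_invariant D w lam s" and "0 < d"
    and no_event: "\<And>d'. \<lbrakk>0 \<le> d'; d' < d\<rbrakk> \<Longrightarrow> \<not> event_occurs D w lam (raise_duals D w d' s)"
  shows "ascent_invariant D w lam (raise_duals D w d s)" (is "ascent_invariant _ _ _ ?s")
proof -
  have sub: "active s \<subseteq> D" "opened s \<subseteq> D"
    and beta: "\<And>i j. i \<in> D \<Longrightarrow> j \<in> D \<Longrightarrow> beta s i j = max 0 (alpha s j - w i j)"
    and tight: "\<And>i. i \<in> opened s \<Longrightarrow> (\<Sum>j\<in>D. beta s i j) = lam"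
    and clock: "\<And>j j'. j \<in> active s \<Longrightarrow> j' \<in> D \<Longrightarrow> alpha s j' \<le> alpha s j"
    and frozen: "\<And>j. j \<in> D - active s \<Longrightarrow> \<exists>i\<in>opened s. w i j \<le> alpha s j \<and>
                   (\<forall>j'\<in>D. beta s i j' > 0 \<longrightarrow> alpha s j' \<le> alpha s j)"
    using inv unfolding ascent_invariant_def by auto
  note unreached = alpha_le_opened_cost[OF \<open>0 < d\<close> no_event]
  have same: "active ?s = active s" "opened ?s = opened s"
    by (simp_all add: raise_duals_def)
  have alpha': "alpha ?s j = (if j \<in> active s then alpha s j + d else alpha s j)" for j
    by (simp add: raise_duals_def)
  have beta_opened: "beta ?s i j = beta s i j" if "i \<in> opened s" for i j
    using that by (simp add: raise_duals_def)
  \<comment> \<open>For an opened \<open>i\<close> and an active \<open>j\<close>,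
    \<open>beta\<close> stands still while \<open>alpha\<close> grows, but \<open>j\<close> has not
    passed \<open>w i j\<close>, so both sides are 0.\<close>
  have beta': "beta ?s i j = max 0 (alpha ?s j - w i j)" if "i \<in> D" "j \<in> D" for i j
    using beta[OF that] that \<open>0 < d\<close> unreached[of j i]
    by (auto simp: raise_duals_def max_def min_def)
  have "\<exists>i\<in>opened s. w i j \<le> alpha ?s j \<and>
          (\<forall>j'\<in>D. beta ?s i j' > 0 \<longrightarrow> alpha ?s j' \<le> alpha ?s j)"
    if j: "j \<in> D - active s" for j
  proof -
    obtain i where i: "i \<in> opened s" "w i j \<le> alpha s j"
      and le: "\<And>j'. j' \<in> D \<Longrightarrow> beta s i j' > 0 \<Longrightarrow> alpha s j' \<le> alpha s j"
      using frozen[OF j] by blast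
    have "alpha ?s j' \<le> alpha ?s j" if "j' \<in> D" "beta ?s i j' > 0" for j'
    proof -
      have "beta s i j' > 0"
        using that(2) i(1) by (simp add: beta_opened)
      \<comment> \<open>An active client still has \<open>alpha\<close> below the cost of an opened
        center and contributes nothing to it. So contributors are frozen and keep their
        \<open>alpha\<close>.\<close>
      moreover from this have "j' \<notin> active s"
        using beta[of i j'] unreached[of j' i] that(1) i(1) sub \<open>0 < d\<close> by auto
      ultimately show ?thesis
        using le[OF that(1)] j by (simp add: alpha')
    qed
    moreover have "w i j \<le> alpha ?s j"
      using i(2) \<open>0 < d\<close> by (simp add: alpha')
    ultimately show ?thesis
      using i(1) by blast
  qed
  moreover have "alpha ?s j' \<le> alpha ?s j" if "j \<in> active s" "j' \<in> D" for j j'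
    using clock[OF that] that(1) \<open>0 < d\<close> by (simp add: alpha')
  moreover have "(\<Sum>j\<in>D. beta ?s i j) = lam" if "i \<in> opened s" for i
    using tight[OF that] by (simp add: beta_opened[OF that])
  ultimately show ?thesis
    unfolding ascent_invariant_def same using sub beta' by blast
qed

lemma ascent_invariant_step:
  assumes "ascent_step D w lam s s'" "ascent_invariant D w lam s"
  shows "ascent_invariant D w lam s'"
  using assms
  by cases (auto intro: ascent_invariant_raise ascent_invariant_freeze ascent_invariant_open)

lemma ascent_invariant_result:
  assumes "\<And>i j. 0 \<le> w i j" "ascent_result D w lam s"
  shows "ascent_invariant D w lam s"
proof -
  have "(ascent_step D w lam)\<^sup>*\<^sup>* (initial_state D) s"
    using assms(2) by (simp add: ascent_result_def)
  then show ?thesis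
    by induction (auto intro: ascent_invariant_initial ascent_invariant_step assms(1))
qed

text \<open>By maximality, adding \<open>i\<close> to \<open>T\<close> makes some client contribute
  to two centers; they cannot both lie in \<open>T\<close>, so one of them is
  \<open>i\<close>.\<close>

lemma pruned_center_conflict:
  assumes "pruning_result D s T" "i \<in> opened s" "i \<notin> T"
  obtains j i' where "j \<in> D" "i' \<in> T" "beta s i j > 0" "beta s i' j > 0"
proof -
  have T: "T \<subseteq> opened s" "no_conflict D s T"
    using assms(1) by (auto simp: pruning_result_def)
  have "\<not> no_conflict D s (insert i T)"
    using assms unfolding pruning_result_def by blast
  then obtain j where j: "j \<in> D" "\<not> (\<exists>\<^sub>\<le>\<^sub>1 i'. i' \<in> insert i T \<and> beta s i' j > 0)"
    unfolding no_conflict_def by blast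
  moreover have "\<exists>\<^sub>\<le>\<^sub>1 i'. i' \<in> T \<and> beta s i' j > 0"
    using T(2) j(1) unfolding no_conflict_def by blast
  ultimately show ?thesis
    using that unfolding Uniq_def by blast
qed

theorem theorem3:
  fixes D :: "'a set" and c :: "'a \<Rightarrow> 'a \<Rightarrow> real"
    and k l :: nat and B eps lam :: real
    and s :: "'a ascent_state" and T S :: "'a set" and near :: "'a \<Rightarrow> 'a"
  assumes "Metric_space D c" and "finite D"
    and "k < card D" and "1 \<le> l" and "l \<le> card D"
    and "0 \<le> B"
    and "lp_opt D c k l B \<le> ereal B"
    and "ereal B \<le> ereal (1 + eps) * centrum_opt D c k l"
    and "0 \<le> lam"
    and "ascent_result D (\<lambda>i j. trunc_cost l B (c i j)) lam s"
    and "pruning_result D s T"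
    and "\<And>j. j \<in> D \<Longrightarrow> is_arg_min (\<lambda>i. c i j) (\<lambda>i. i \<in> T) (near j)"
    and "S = {j \<in> D. \<exists>i\<in>T. beta s i j > 0}"
  shows "3 * lam * real (card T)
           + (\<Sum>j\<in>S. trunc_cost l B (c (near j) j))
           + (\<Sum>j\<in>D - S. trunc_cost l (3 * B) (c (near j) j))
         \<le> 3 * (\<Sum>j\<in>D. alpha s j)"
proof -
  interpret Metric_space D c
    by fact
  define w where "w = (\<lambda>i j. trunc_cost l B (c i j))"
  have w_nonneg: "0 \<le> w i j" for i j
    using \<open>0 \<le> B\<close> by (simp add: w_def trunc_cost_nonneg)
  have result: "ascent_result D w lam s"
    using assms(10) by (simp add: w_def)
  have inv: "ascent_invariant D w lam s"
    by (rule ascent_invariant_result[OF w_nonneg result])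
  have "active s = {}"
    using result by (simp add: ascent_result_def)
  with inv have opened_sub: "opened s \<subseteq> D"
    and beta: "\<And>i j. i \<in> D \<Longrightarrow> j \<in> D \<Longrightarrow> beta s i j = max 0 (alpha s j - w i j)"
    and tight: "\<And>i. i \<in> opened s \<Longrightarrow> (\<Sum>j\<in>D. beta s i j) = lam"
    and frozen: "\<And>j. j \<in> D \<Longrightarrow> \<exists>i\<in>opened s. w i j \<le> alpha s j \<and>
                   (\<forall>j'\<in>D. beta s i j' > 0 \<longrightarrow> alpha s j' \<le> alpha s j)"
    unfolding ascent_invariant_def by auto
  have T_sub: "T \<subseteq> opened s" and unique: "no_conflict D s T"
    using assms(11) by (auto simp: pruning_result_def)
  have T_D: "T \<subseteq> D"
    using T_sub opened_sub by blast
  have fin_T: "finite T"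
    using T_D \<open>finite D\<close> by (rule finite_subset)
  have near_le: "c (near j) j \<le> c i j" if "j \<in> D" "i \<in> T" for i j
    using assms(12)[OF that(1)] that(2) by (auto simp: is_arg_min_def not_less)

  \<comment> \<open>Only one center of \<open>T\<close> receives from \<open>j\<close>, so the sum
    is \<open>alpha s j - w i j\<close>; tripled, it leaves \<open>3 * w i j\<close> for a
    connection cost of at most \<open>w i j\<close>.\<close>
  have paid_S: "3 * (\<Sum>i\<in>T. beta s i j) + trunc_cost l B (c (near j) j) \<le> 3 * alpha s j"
    if "j \<in> S" for j
  proof -
    obtain i where i: "j \<in> D" "i \<in> T" "beta s i j > 0"
      using \<open>j \<in> S\<close> assms(13) by blast
    have "beta s i' j = 0" if "i' \<in> T - {i}" for i'
    proof -
      have "\<not> beta s i' j > 0"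
        using that i unique unfolding no_conflict_def Uniq_def by blast
      then show ?thesis
        using that beta[of i' j] T_D i(1) by auto
    qed
    then have "(\<Sum>i\<in>T. beta s i j) = beta s i j"
      by (simp add: sum.remove[OF fin_T i(2)])
    moreover have "beta s i j = alpha s j - w i j"
      using i beta[of i j] T_D by auto
    moreover have "trunc_cost l B (c (near j) j) \<le> w i j"
      using trunc_cost_mono[OF \<open>0 \<le> B\<close> near_le[OF i(1,2)]] by (simp add: w_def)
    ultimately show ?thesis
      using w_nonneg[of i j] by simp
  qed

  have paid_rest: "trunc_cost l (3 * B) (c (near j) j) \<le> 3 * alpha s j" if j: "j \<in> D - S" for j
  proof -
    obtain i where i: "i \<in> opened s" "w i j \<le> alpha s j"
      and le: "\<And>j'. j' \<in> D \<Longrightarrow> beta s i j' > 0 \<Longrightarrow> alpha s j' \<le> alpha s j"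
      using frozen j by blast
    show ?thesis
    proof (cases "i \<in> T")
      case True
      then have "c (near j) j \<le> c i j"
        using near_le j by blast
      \<comment> \<open>The single edge is padded to three so that the bound for three-edge paths
        applies.\<close>
      then have "c (near j) j \<le> c i j + c i j + c i j"
        using nonneg[of i j] by linarith
      then show ?thesis
        using i(2) unfolding w_def by (blast intro: trunc_cost_le_triple[OF \<open>0 \<le> B\<close>])
    next
      case False
      then obtain j' i' where j': "j' \<in> D" "i' \<in> T" "beta s i j' > 0" "beta s i' j' > 0"
        using pruned_center_conflict[OF assms(11) i(1)] by blast
      have D: "i \<in> D" "i' \<in> D" "j \<in> D"
        using i(1) j'(2) opened_sub T_D j by auto
      have "c (near j) j \<le> c i' j' + c i j' + c i j"
        using near_le[OF D(3) j'(2)] triangle[OF D(2) j'(1) D(3)] triangle[OF j'(1) D(1) D(3)]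
          commute[of j' i] by simp
      \<comment> \<open>Positive contributions put both costs below \<open>alpha s j'\<close>, which
        the freezing center bounds by \<open>alpha s j\<close>.\<close>
      moreover have "w i' j' \<le> alpha s j" "w i j' \<le> alpha s j"
        using j' le[OF j'(1,3)] beta[of i j'] beta[of i' j'] D by auto
      ultimately show ?thesis
        using i(2) unfolding w_def by (blast intro: trunc_cost_le_triple[OF \<open>0 \<le> B\<close>])
    qed
  qed

  have S_D: "S \<subseteq> D"
    using assms(13) by auto
  \<comment> \<open>Each center of \<open>T\<close> collects its whole \<open>lam\<close> from
    clients in \<open>S\<close>; swapping the sums then charges \<open>lam * card T\<close> to these
    clients.\<close>
  have "beta s i j = 0" if "i \<in> T" "j \<in> D - S" for i j
    using that beta[of i j] T_D assms(13) by fastforce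
  then have "(\<Sum>j\<in>S. beta s i j) = lam" if "i \<in> T" for i
    using that tight[of i] T_sub S_D
      sum.mono_neutral_right[OF \<open>finite D\<close> S_D, of "beta s i"] by auto
  then have "lam * real (card T) = (\<Sum>i\<in>T. \<Sum>j\<in>S. beta s i j)"
    by simp
  also have "\<dots> = (\<Sum>j\<in>S. \<Sum>i\<in>T. beta s i j)"
    by (rule sum.swap)
  finally have "3 * lam * real (card T) + (\<Sum>j\<in>S. trunc_cost l B (c (near j) j))
      = (\<Sum>j\<in>S. 3 * (\<Sum>i\<in>T. beta s i j) + trunc_cost l B (c (near j) j))"
    by (simp add: sum.distrib flip: sum_distrib_left)
  also have "\<dots> \<le> (\<Sum>j\<in>S. 3 * alpha s j)"
    by (intro sum_mono paid_S)
  finally have "3 * lam * real (card T) + (\<Sum>j\<in>S. trunc_cost l B (c (near j) j))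
      + (\<Sum>j\<in>D - S. trunc_cost l (3 * B) (c (near j) j))
      \<le> (\<Sum>j\<in>S. 3 * alpha s j) + (\<Sum>j\<in>D - S. 3 * alpha s j)"
    by (intro add_mono sum_mono paid_rest)
  also have "\<dots> = 3 * (\<Sum>j\<in>D. alpha s j)"
    using sum.subset_diff[OF S_D \<open>finite D\<close>, of "\<lambda>j. 3 * alpha s j"]
    by (simp add: sum_distrib_left)
  finally show ?thesis .
qed

end
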